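(* For every $n\ge 1$ there is a word over $\mathbb{P}$ (equivalently, a permutation) of length $\lceil (n^2+1)/2\rceil$ that contains, for every permutation $\pi$ of length $n$, a subsequence order-isomorphic to $\pi$.
   Context: $\mathbb{P}$ is the set of positive integers. A permutation of length $n$ is a word containing each letter of $[n]$ exactly once. Words $u,v$ of length $k$ are order-isomorphic if $u(i)>u(j)\iff v(i)>v(j)$ for all $i,j\in[k]$. A word $w$ contains a subsequence order-isomorphic to $\pi$ if there are indices $i_1<\cdots<i_n$ with $w(i_1)\cdots w(i_n)$ order-isomorphic to $\pi$. *)

theory Defs
  imports Complex_Main
begin

definition is_perm :: "nat \<Rightarrow> nat list \<Rightarrow> bool" where
  "is_perm n p \<longleftrightarrow> length p = n \<and> distinct p \<and> set p = {1..n}"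

definition order_iso :: "nat list \<Rightarrow> nat list \<Rightarrow> bool" where
  "order_iso u v \<longleftrightarrow> length u = length v \<and>
     (\<forall>i<length u. \<forall>j<length u. (u ! i > u ! j) = (v ! i > v ! j))"

definition contains_pattern :: "nat list \<Rightarrow> nat list \<Rightarrow> bool" where
  "contains_pattern w p \<longleftrightarrow>
     (\<exists>idx :: nat \<Rightarrow> nat.
        (\<forall>k. Suc k < length p \<longrightarrow> idx k < idx (Suc k)) \<and>
        (\<forall>k<length p. idx k < length w) \<and>
        order_iso (map (\<lambda>k. w ! idx k) [0..<length p]) p)"

end

theory Submission
  imports Defs
begin

text \<open>
  Concatenate runs 1, ..., \<open>n\<close>, where an odd run lists the odd letters of \<open>[n]\<close> increasingly and an even
  run lists the even letters decreasingly; for even \<open>n\<close> insert one more letter \<open>n - 1\<close> right after the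
  \<open>n\<close> of run \<open>n\<close>. Ties between equal letters are then broken so that the earlier one is larger.

  If \<open>j + 1\<close> precedes \<open>j\<close> in a permutation but not immediately, merging the two values gives words
  \<open>u\<close> and \<open>u + 1\<close> over \<open>[n]\<close>, and either embeds the permutation. Between consecutive letters the greedy
  embeddings of \<open>u\<close> and \<open>u + 1\<close> together advance exactly two runs, so the final runs sum to
  \<open>2 n + 1\<close> and one of them is at most \<open>n\<close>. Otherwise the permutation is layered (a direct sum of
  decreasing permutations), and its greedy embedding fits into \<open>n\<close> runs except when \<open>n\<close> and the
  size of the last layer are even. In that case the last layer is embedded with many ties
  as \<open>n - 1, ..., n - 1, n - 2, n - 4, ...\<close>, using the extra letter.
\<close>

section \<open>Runs, cells and greedy embeddings\<close>

definition run_less :: "nat \<Rightarrow> nat \<Rightarrow> nat \<Rightarrow> bool" where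
  "run_less r x y \<longleftrightarrow> (if odd r then x < y else y < x)"

definition cell_less :: "nat \<times> nat \<Rightarrow> nat \<times> nat \<Rightarrow> bool" where
  "cell_less c d \<longleftrightarrow> fst c < fst d \<or> fst c = fst d \<and> run_less (fst c) (snd c) (snd d)"

text \<open>A cell \<open>(r, v)\<close> is the occurrence of the letter \<open>v\<close> in run \<open>r\<close>.\<close>

definition cells :: "nat \<Rightarrow> (nat \<times> nat) set" where
  "cells n = {(r, v). r \<in> {1..n} \<and> v \<in> {1..n} \<and> even (r + v)} \<union> (if even n \<and> n > 0 then {(n, n - 1)} else {})"

text \<open>Encodes the order of the cells in the word as numbers: base \<open>n + 1\<close> leaves
  room for letters up to \<open>n\<close>, and \<open>n - snd c\<close> reverses the even
  runs.\<close>

definition cell_key :: "nat \<Rightarrow> nat \<times> nat \<Rightarrow> nat" where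
  "cell_key n c = fst c * (n + 1) + (if odd (fst c) then snd c else n - snd c)"

text \<open>The summand \<open>B - a\<close> breaks ties: of two equal letters the earlier becomes the larger.\<close>

definition zigzag_word :: "nat \<Rightarrow> nat list" where
  "zigzag_word n = (let B = Suc (Max (cell_key n ` cells n)) in
     map (\<lambda>a. snd (inv_into (cells n) (cell_key n) a) * B + (B - a))
       (sorted_list_of_set (cell_key n ` cells n)))"

text \<open>The least number of runs to advance from an occurrence of \<open>x\<close> to a later
  one of \<open>y\<close>, ignoring the extra cell. Runs have the parity of their letters, so
  \<open>x\<close> can serve as the run number in \<open>run_less x x y\<close>.\<close>

definition step_cost :: "nat \<Rightarrow> nat \<Rightarrow> nat" where
  "step_cost x y = (if odd (x + y) then 1 else if run_less x x y then 0 else 2)"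

primrec greedy_run :: "(nat \<Rightarrow> nat) \<Rightarrow> nat \<Rightarrow> nat" where
  "greedy_run u 0 = (if odd (u 0) then 1 else 2)"
| "greedy_run u (Suc k) = greedy_run u k + step_cost (u k) (u (Suc k))"

lemma cells_subset: "cells n \<subseteq> {1..n} \<times> {..n}"
  by (auto simp: cells_def)

lemma finite_cells: "finite (cells n)"
  using cells_subset by (rule finite_subset) simp

lemma cell_key_mono:
  assumes "cell_less c d" "snd c \<le> n" "snd d \<le> n"
  shows "cell_key n c < cell_key n d"
proof (cases "fst c < fst d")
  case True
  have "cell_key n c < (fst c + 1) * (n + 1)"
    using assms by (auto simp: cell_key_def)
  also have "\<dots> \<le> fst d * (n + 1)"
    using True by (intro mult_right_mono) auto
  also have "\<dots> \<le> cell_key n d" by (simp add: cell_key_def)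
  finally show ?thesis .
next
  case False
  then show ?thesis
    using assms by (auto simp: cell_less_def run_less_def cell_key_def split: if_splits)
qed

lemma cell_less_linear: "c = d \<or> cell_less c d \<or> cell_less d c"
  by (auto simp: cell_less_def run_less_def prod_eq_iff)

lemma inj_on_cell_key: "inj_on (cell_key n) (cells n)"
proof (rule inj_onI)
  fix c d assume cd: "c \<in> cells n" "d \<in> cells n" "cell_key n c = cell_key n d"
  then have "snd c \<le> n" "snd d \<le> n" using cells_subset by fastforce+
  then show "c = d"
    using cell_less_linear[of c d] cell_key_mono[of c d n] cell_key_mono[of d c n] cd(3) by auto
qed

section \<open>Counting the cells\<close>

lemma card_odd: "card {v \<in> {1..n::nat}. odd v} = (n + 1) div 2"
proof (induction n)
  case (Suc n)
  let ?A = "{v \<in> {1..n}. odd v}"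
  show ?case
  proof (cases "even n")
    case True
    have "{v \<in> {1..Suc n}. odd v} = insert (Suc n) ?A"
      using True by (auto simp: le_Suc_eq)
    moreover have "card (insert (Suc n) ?A) = Suc (card ?A)" by (rule card_insert_disjoint) auto
    ultimately have "card {v \<in> {1..Suc n}. odd v} = Suc ((n + 1) div 2)"
      by (simp only: Suc.IH)
    then show ?thesis using True by presburger
  next
    case False
    then have "{v \<in> {1..Suc n}. odd v} = ?A" by (auto simp: le_Suc_eq)
    then have "card {v \<in> {1..Suc n}. odd v} = (n + 1) div 2" by (simp only: Suc.IH)
    then show ?thesis using False by presburger
  qed
qed simp

lemma card_even: "card {v \<in> {1..n::nat}. even v} = n div 2"
proof -
  let ?O = "{v \<in> {1..n}. odd v}" and ?E = "{v \<in> {1..n}. even v}"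
  have "card (?O \<union> ?E) = card ?O + card ?E" by (rule card_Un_disjoint) auto
  moreover have "?O \<union> ?E = {1..n}" by auto
  ultimately have "n = (n + 1) div 2 + card ?E" unfolding card_odd by (metis card_atLeastAtMost diff_Suc_1)
  then show ?thesis by presburger
qed

text \<open>The parity condition leaves an odd-by-odd and an even-by-even block:
  \<open>(m + 1)^2 + m^2\<close> cells for \<open>n = 2 * m + 1\<close>, and \<open>2 * m^2\<close>
  for \<open>n = 2 * m\<close>, where the extra cell supplies the missing 1.\<close>

lemma card_cells:
  assumes "n \<ge> 1"
  shows "card (cells n) = nat \<lceil>(real n ^ 2 + 1) / 2\<rceil>"
proof -
  let ?O = "{v \<in> {1..n}. odd v}" and ?E = "{v \<in> {1..n}. even v}"
  let ?C = "?O \<times> ?O \<union> ?E \<times> ?E"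
  have C: "card ?C = ((n + 1) div 2)\<^sup>2 + (n div 2)\<^sup>2"
    by (subst card_Un_disjoint)
      (auto simp: card_cartesian_product card_odd[simplified] card_even[simplified] power2_eq_square)
  have cells: "cells n = ?C \<union> (if even n then {(n, n - 1)} else {})"
    using assms by (auto simp: cells_def)
  show ?thesis
  proof (cases "even n")
    case True
    then obtain m where m: "n = 2 * m" by blast
    have "(n, n - 1) \<notin> ?C" using True assms by auto
    then have "card (cells n) = Suc (card ?C)" unfolding cells using True by simp
    then have "card (cells n) = 2 * m\<^sup>2 + 1" using C m by simp
    moreover have "\<lceil>(real n ^ 2 + 1) / 2\<rceil> = int (2 * m\<^sup>2 + 1)"
      unfolding m by (rule ceiling_unique) (auto simp: power_mult_distrib)
    ultimately show ?thesis by (simp only: nat_int)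
  next
    case False
    then obtain m where m: "n = 2 * m + 1" using oddE by blast
    have "card (cells n) = (m + 1)\<^sup>2 + m\<^sup>2" unfolding cells using False C m by simp
    moreover have "\<lceil>(real n ^ 2 + 1) / 2\<rceil> = int ((m + 1)\<^sup>2 + m\<^sup>2)"
      unfolding m by (rule ceiling_unique) (auto simp: power2_eq_square field_simps)
    ultimately show ?thesis by (simp only: nat_int)
  qed
qed

section \<open>From cells to subsequences of the word\<close>

lemma length_zigzag_word: "length (zigzag_word n) = card (cells n)"
  by (simp add: zigzag_word_def Let_def card_image inj_on_cell_key)

lemma zigzag_word_pos:
  assumes "x \<in> set (zigzag_word n)"
  shows "x \<ge> 1"
proof -
  define K where "K = cell_key n ` cells n"
  define B where "B = Suc (Max K)"
  have "finite K" by (simp add: K_def finite_cells)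
  from assms obtain a y where "a \<in> set (sorted_list_of_set K)" "x = y + (B - a)"
    unfolding zigzag_word_def Let_def K_def[symmetric] B_def[symmetric] set_map by blast
  moreover from this(1) have "a \<le> Max K" using \<open>finite K\<close> by simp
  ultimately show ?thesis by (simp add: B_def)
qed

lemma strict_mono_below:
  fixes f :: "nat \<Rightarrow> nat"
  assumes "\<And>k. Suc k < n \<Longrightarrow> f k < f (Suc k)" "i < j" "j < n"
  shows "f i < f j"
  using assms(2,3)
proof (induction j)
  case (Suc j)
  then show ?case using assms(1)[of j] by (cases "i = j") auto
qed simp

text \<open>Embeddings can now be built from cells alone. Equal letters under \<open>h\<close> stand
  for a descent of \<open>p\<close>, because the word makes the earlier copy larger.\<close>

lemma contains_pattern_zigzag_wordI:
  assumes p: "is_perm n p"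
    and h: "\<And>k. k < n \<Longrightarrow> h k \<in> cells n"
    and inc: "\<And>k. Suc k < n \<Longrightarrow> cell_less (h k) (h (Suc k))"
    and iso: "\<And>i j. i < j \<Longrightarrow> j < n \<Longrightarrow> p ! i < p ! j \<longleftrightarrow> snd (h i) < snd (h j)"
  shows "contains_pattern (zigzag_word n) p"
proof -
  define K where "K = cell_key n ` cells n"
  define L where "L = sorted_list_of_set K"
  define B where "B = Suc (Max K)"
  define key where "key = (\<lambda>k. cell_key n (h k))"
  have K: "finite K" "set L = K" "sorted L"
    by (auto simp: K_def L_def finite_cells)
  have len: "length p = n" and dist: "distinct p" using p by (auto simp: is_perm_def)
  have keyK: "key k \<in> set L" if "k < n" for k
    using h[OF that] K by (auto simp: key_def K_def)
  have keyB: "key k < B" if "k < n" for k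
    using keyK[OF that] K by (auto simp: B_def less_Suc_eq_le)
  have snd_le: "snd (h k) \<le> n" if "k < n" for k
    using h[OF that] cells_subset by fastforce
  have key_Suc: "key k < key (Suc k)" if "Suc k < n" for k
    unfolding key_def using inc[OF that] that by (intro cell_key_mono snd_le) auto
  have key_less: "key i < key j" if "i < j" "j < n" for i j
    using strict_mono_below[of n key i j] key_Suc that by blast
  have "\<forall>k. \<exists>i. k < n \<longrightarrow> i < length L \<and> L ! i = key k"
    using keyK by (metis in_set_conv_nth)
  then obtain idx where idx: "\<And>k. k < n \<Longrightarrow> idx k < length L \<and> L ! idx k = key k"
    by metis
  have w: "zigzag_word n ! idx k = snd (h k) * B + (B - key k)" if "k < n" for k
  proof -
    have "inv_into (cells n) (cell_key n) (key k) = h k"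
      unfolding key_def using h[OF that] inj_on_cell_key by simp
    then show ?thesis
      using idx[OF that] by (simp add: zigzag_word_def Let_def flip: K_def L_def B_def)
  qed
  \<comment> \<open>As \<open>B\<close> exceeds every key, two summands \<open>B - key\<close>
    differ by less than \<open>B\<close>: they never outweigh a difference of letters and only
    decide ties, where the earlier cell wins.\<close>
  have cmp: "zigzag_word n ! idx j < zigzag_word n ! idx i \<longleftrightarrow> snd (h j) \<le> snd (h i)"
    "zigzag_word n ! idx i < zigzag_word n ! idx j \<longleftrightarrow> snd (h i) < snd (h j)"
    if ij: "i < j" "j < n" for i j
  proof -
    have k: "key i < key j" "key i < B" "key j < B" using key_less keyB ij by auto
    have less: "zigzag_word n ! idx j < zigzag_word n ! idx i" if "snd (h j) \<le> snd (h i)"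
    proof -
      have "snd (h j) * B \<le> snd (h i) * B" using that by simp
      then show ?thesis using w[of i] w[of j] ij k by linarith
    qed
    have greater: "zigzag_word n ! idx i < zigzag_word n ! idx j" if "snd (h i) < snd (h j)"
    proof -
      have "Suc (snd (h i)) * B \<le> snd (h j) * B" using that by (intro mult_right_mono) auto
      moreover have "B - key i \<le> B" "B - key j > 0" using k by auto
      moreover have "Suc (snd (h i)) * B = snd (h i) * B + B" by simp
      ultimately show ?thesis using w[of i] w[of j] ij by linarith
    qed
    show "zigzag_word n ! idx j < zigzag_word n ! idx i \<longleftrightarrow> snd (h j) \<le> snd (h i)"
      "zigzag_word n ! idx i < zigzag_word n ! idx j \<longleftrightarrow> snd (h i) < snd (h j)"
      using less greater by linarith+
  qed
  have "idx k < idx (Suc k)" if "Suc k < n" for k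
  proof (rule ccontr)
    assume "\<not> ?thesis"
    then have "L ! idx (Suc k) \<le> L ! idx k"
      using idx[of k] that K(3) by (intro sorted_nth_mono) auto
    then show False using key_Suc[OF that] idx[of k] idx[of "Suc k"] that by auto
  qed
  moreover have "length (zigzag_word n) = length L"
    by (simp add: zigzag_word_def Let_def L_def K_def)
  then have "idx k < length (zigzag_word n)" if "k < n" for k
    using idx[OF that] by simp
  moreover have "(zigzag_word n ! idx i > zigzag_word n ! idx j) = (p ! i > p ! j)"
    if ij: "i < n" "j < n" for i j
  proof (cases i j rule: linorder_cases)
    case less
    have "p ! i \<noteq> p ! j" using less ij dist len by (simp add: nth_eq_iff_index_eq)
    then show ?thesis using cmp(1)[OF less ij(2)] iso[OF less ij(2)] by linarith
  next
    case greater
    then show ?thesis using cmp(2)[OF greater ij(1)] iso[OF greater ij(1)] by simp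
  qed simp
  ultimately show ?thesis
    unfolding contains_pattern_def order_iso_def len by (intro exI[of _ idx]) auto
qed

section \<open>Properties of greedy embeddings\<close>

text \<open>Each \<open>step_cost\<close> has the parity of the sum of its two letters, so letter
  and run change parity together.\<close>

lemma even_greedy_run: "even (greedy_run u k + u k)"
  by (induction k) (auto simp: step_cost_def)

lemma greedy_run_mono: "i \<le> j \<Longrightarrow> greedy_run u i \<le> greedy_run u j"
  by (rule lift_Suc_mono_le[of "greedy_run u"]) simp_all

lemma greedy_run_ge_1: "greedy_run u k \<ge> 1"
proof -
  have "1 \<le> greedy_run u 0" by simp
  then show ?thesis using greedy_run_mono[of 0 k u] by linarith
qed

lemma cell_less_greedy_run:
  "cell_less (greedy_run u k, u k) (greedy_run u (Suc k), u (Suc k))"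
  using even_greedy_run[of u k] by (auto simp: cell_less_def step_cost_def run_less_def)

lemma contains_pattern_greedy:
  assumes p: "is_perm n p"
    and u: "\<And>k. k < n \<Longrightarrow> u k \<in> {1..n}"
    and run: "greedy_run u (n - 1) \<le> n"
    and iso: "\<And>i j. i < j \<Longrightarrow> j < n \<Longrightarrow> p ! i < p ! j \<longleftrightarrow> u i < u j"
  shows "contains_pattern (zigzag_word n) p"
proof (rule contains_pattern_zigzag_wordI[OF p, where h = "\<lambda>k. (greedy_run u k, u k)"])
  fix k assume "k < n"
  then have "k \<le> n - 1" by simp
  from greedy_run_mono[OF this] have "greedy_run u k \<le> n" using run by (rule order_trans)
  then show "(greedy_run u k, u k) \<in> cells n"
    using u[OF \<open>k < n\<close>] even_greedy_run[of u k] greedy_run_ge_1[of u k] by (simp add: cells_def)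
next
  fix k show "cell_less (greedy_run u k, u k) (greedy_run u (Suc k), u (Suc k))"
    by (rule cell_less_greedy_run)
next
  fix i j assume "i < j" "j < n"
  then show "p ! i < p ! j \<longleftrightarrow> snd (greedy_run u i, u i) < snd (greedy_run u j, u j)"
    using iso by simp
qed

section \<open>Merging two consecutive values\<close>

text \<open>The shift exchanges odd and even runs, hence the costs 0 and 2, while a change of parity
  costs 1 both times; the start contributes 1 + 2. A repeated letter would cost 2 twice.\<close>

lemma greedy_run_add_shift:
  assumes "\<And>k. k < m \<Longrightarrow> u k \<noteq> u (Suc k)"
  shows "greedy_run u m + greedy_run (\<lambda>k. Suc (u k)) m = 2 * m + 3"
  using assms
proof (induction m)
  case (Suc m)
  have "step_cost (u m) (u (Suc m)) + step_cost (Suc (u m)) (Suc (u (Suc m))) = 2"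
    using Suc.prems[of m] by (auto simp: step_cost_def run_less_def)
  with Suc show ?case by auto
qed auto

lemma contains_pattern_distant:
  assumes p: "is_perm n p"
    and ij: "Suc i < j" "j < n" "p ! i = Suc (p ! j)"
  shows "contains_pattern (zigzag_word n) p"
proof -
  \<comment> \<open>Identifies \<open>p ! i\<close> with \<open>p ! j\<close> and closes the gap
    above, so that \<open>Suc (u k)\<close> still lies in \<open>{1..n}\<close>.\<close>
  define u where "u = (\<lambda>k. if p ! k \<le> p ! j then p ! k else p ! k - 1)"
  have len: "length p = n" and dist: "distinct p" and set: "set p = {1..n}"
    using p by (auto simp: is_perm_def)
  have inj: "p ! s = p ! t \<longleftrightarrow> s = t" if "s < n" "t < n" for s t
    using that dist len by (simp add: nth_eq_iff_index_eq)
  have range: "p ! k \<in> {1..n}" if "k < n" for k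
    using that set len nth_mem by blast
  have u: "1 \<le> u k \<and> Suc (u k) \<le> n" if "k < n" for k
    using range[OF that] range[of i] range[of j] ij by (auto simp: u_def)
  \<comment> \<open>The only tie is between \<open>i\<close> and \<open>j\<close>, where
    \<open>p\<close> descends.\<close>
  have iso: "p ! s < p ! t \<longleftrightarrow> u s < u t" if st: "s < t" "t < n" for s t
  proof -
    have "\<not> (p ! s = p ! j \<and> p ! t = p ! i)" using inj[of s j] inj[of t i] st ij by auto
    then show ?thesis using inj[of s t] st ij(3) by (auto simp: u_def)
  qed
  \<comment> \<open>The tied positions are not adjacent, since \<open>Suc i < j\<close>.\<close>
  have "u k \<noteq> u (Suc k)" if "k < n - 1" for k
  proof -
    have "\<not> (p ! k = p ! i \<and> p ! Suc k = p ! j)"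
      using inj[of k i] inj[of "Suc k" j] that ij by auto
    moreover have "\<not> (p ! k = p ! j \<and> p ! Suc k = p ! i)"
      using inj[of k j] inj[of "Suc k" i] that ij by auto
    moreover have "p ! k \<noteq> p ! Suc k" using inj[of k "Suc k"] that by simp
    ultimately show ?thesis unfolding u_def using ij(3) by presburger
  qed
  \<comment> \<open>The final runs sum to \<open>2 * (n - 1) + 3 = 2 * n + 1\<close>, so they cannot
    both exceed \<open>n\<close>.\<close>
  from greedy_run_add_shift[of "n - 1" u, OF this]
  consider "greedy_run u (n - 1) \<le> n" | "greedy_run (\<lambda>k. Suc (u k)) (n - 1) \<le> n"
    using ij by linarith
  then show ?thesis
  proof cases
    case 1
    then show ?thesis using u iso by (intro contains_pattern_greedy[OF p, of u]) force+
  next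
    case 2
    then show ?thesis using u iso by (intro contains_pattern_greedy[OF p, of "\<lambda>k. Suc (u k)"]) auto
  qed
qed

section \<open>Layered permutations\<close>

text \<open>
  The run in which the greedy embedding of a layered permutation stands after \<open>k\<close> letters, if a layer
  ends there with the letter \<open>a\<close>.
\<close>

definition layer_end :: "nat \<Rightarrow> nat \<Rightarrow> nat" where
  "layer_end k a = (if even (k + a) then k else if even k then k + 1 else k - 1)"

text \<open>
  Position \<open>k\<close> is a boundary between layers, and the greedy embedding has reached the run predicted
  by \<^const>\<open>layer_end\<close>.
\<close>

definition layer_cut :: "nat list \<Rightarrow> nat \<Rightarrow> bool" where
  "layer_cut p k \<longleftrightarrow> k \<le> length p \<and> (!) p ` {..<k} = {1..k} \<and>
     (k > 0 \<longrightarrow> greedy_run ((!) p) (k - 1) = layer_end k (p ! (k - 1)))"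

lemma greedy_run_descending:
  assumes "\<And>t. t \<le> m \<Longrightarrow> u (k + t) = b - t" "m \<le> b"
  shows "greedy_run u (k + m) = greedy_run u k + m"
  using assms
proof (induction m)
  case (Suc m)
  have "u (k + m) = b - m" "u (Suc (k + m)) = b - Suc m"
    using Suc.prems(1)[of m] Suc.prems(1)[of "Suc m"] by auto
  then have "step_cost (u (k + m)) (u (Suc (k + m))) = 1"
    using Suc.prems(2) by (auto simp: step_cost_def)
  with Suc show ?case by auto
qed simp

text \<open>The values \<open>k + 1, ..., p ! k - 1\<close> can only occur after position
  \<open>k\<close>, since the earlier positions hold \<open>1..k\<close>. By \<open>adj\<close> each
  of them, in decreasing order, directly follows its successor value, so the layer fills the
  positions up to \<open>p ! k - 1\<close>.\<close>

lemma layer_cut_next: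
  assumes p: "is_perm n p"
    and adj: "\<forall>i j. i < j \<and> j < n \<and> p ! i = Suc (p ! j) \<longrightarrow> j = Suc i"
    and cut: "layer_cut p k" "k < n"
  shows "k < p ! k" "\<And>t. t < p ! k - k \<Longrightarrow> p ! (k + t) = p ! k - t" "layer_cut p (p ! k)"
proof -
  define b where "b = p ! k"
  have len: "length p = n" and dist: "distinct p" and set: "set p = {1..n}"
    using p by (auto simp: is_perm_def)
  have inj: "p ! s = p ! t \<longleftrightarrow> s = t" if "s < n" "t < n" for s t
    using that dist len by (simp add: nth_eq_iff_index_eq)
  have img: "(!) p ` {..<k} = {1..k}" using cut by (simp add: layer_cut_def)
  have range: "p ! i \<in> {1..n}" if "i < n" for i
    using that set len nth_mem by blast
  have lower: "k < p ! i" if i: "k \<le> i" "i < n" for i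
  proof (rule ccontr)
    assume "\<not> k < p ! i"
    then have "p ! i \<in> (!) p ` {..<k}" using range[OF i(2)] img by auto
    then show False using inj i by auto
  qed
  show kb: "k < p ! k" using lower cut(2) by simp
  have bn: "b \<le> n" using range[OF cut(2)] b_def by simp
  have desc: "p ! (k + t) = b - t" if "t < b - k" for t
    using that
  proof (induction t rule: less_induct)
    case (less t)
    show ?case
    proof (cases t)
      case 0
      then show ?thesis by (simp add: b_def)
    next
      case (Suc s)
      have "b - t \<in> set p" using less.prems bn set by auto
      then obtain i where i: "i < n" "p ! i = b - t" using len by (auto simp: in_set_conv_nth)
      have "k \<le> i"
      proof (rule ccontr)
        assume "\<not> k \<le> i"
        then have "p ! i \<in> {1..k}" using img by auto
        then show False using i less.prems by auto
      qed
      moreover have "i \<noteq> k + r" if "r \<le> s" for r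
        using less.IH[of r] that Suc less.prems i(2) by auto
      ultimately have "k + s < i" by (metis le_iff_add linorder_not_le add_le_cancel_left)
      moreover have "p ! (k + s) = Suc (p ! i)" using less.IH[of s] Suc less.prems i by auto
      ultimately have "i = Suc (k + s)" using adj i(1) by blast
      then show ?thesis using i Suc by simp
    qed
  qed
  then show "\<And>t. t < p ! k - k \<Longrightarrow> p ! (k + t) = p ! k - t" by (simp add: b_def)
  have "(!) p ` {k..<b} = {Suc k..b}"
  proof (rule card_subset_eq)
    show "(!) p ` {k..<b} \<subseteq> {Suc k..b}"
    proof
      fix x assume "x \<in> (!) p ` {k..<b}"
      then obtain i where i: "k \<le> i" "i < b" "x = p ! i" by auto
      then have "x = b - (i - k)" using desc[of "i - k"] by auto
      then show "x \<in> {Suc k..b}" using i by auto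
    qed
    have "inj_on ((!) p) {k..<b}" using inj bn by (auto simp: inj_on_def)
    then show "card ((!) p ` {k..<b}) = card {Suc k..b}" by (simp add: card_image)
  qed simp
  moreover have "{..<b} = {..<k} \<union> {k..<b}" "{1..b} = {1..k} \<union> {Suc k..b}"
    using kb b_def by auto
  ultimately have img_b: "(!) p ` {..<b} = {1..b}" using img by (simp add: image_Un)
  have last: "p ! (b - 1) = Suc k" using desc[of "b - 1 - k"] kb b_def by auto
  have "greedy_run ((!) p) (k + (b - 1 - k)) = greedy_run ((!) p) k + (b - 1 - k)"
    using desc kb b_def by (intro greedy_run_descending[where b = b]) auto
  then have run_b: "greedy_run ((!) p) (b - 1) = greedy_run ((!) p) k + (b - 1 - k)"
    using kb b_def by simp
  \<comment> \<open>Whatever letter precedes it, \<open>b\<close> lands in the odd one of the runs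
    \<open>k\<close> and \<open>k + 1\<close> if \<open>b\<close> is odd, and in the even run after
    that one if \<open>b\<close> is even. The descent then costs one run per letter.\<close>
  have "greedy_run ((!) p) (b - 1) = layer_end b (Suc k)"
  proof (cases k)
    case 0
    then show ?thesis using run_b kb b_def by (auto simp: layer_end_def)
  next
    case (Suc m)
    have "p ! m \<in> {1..k}" using img Suc by auto
    then have "p ! m < b" using kb b_def by auto
    moreover have "greedy_run ((!) p) m = layer_end k (p ! m)" using cut(1) Suc
      by (simp add: layer_cut_def)
    moreover have "greedy_run ((!) p) k = greedy_run ((!) p) m + step_cost (p ! m) b"
      by (simp add: Suc b_def)
    ultimately show ?thesis
      using run_b kb Suc unfolding b_def[symmetric]
      by (auto simp: layer_end_def step_cost_def run_less_def)
  qed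
  then show "layer_cut p (p ! k)"
    using img_b bn len last unfolding layer_cut_def b_def[symmetric] by simp
qed

text \<open>Every cut \<open>k < n\<close> yields the larger cut \<open>p ! k\<close>, so from the
  largest cut below \<open>n\<close> the next one must be \<open>n\<close>.\<close>

lemma last_layer:
  assumes p: "is_perm n p" and n: "n \<ge> 1"
    and adj: "\<forall>i j. i < j \<and> j < n \<and> p ! i = Suc (p ! j) \<longrightarrow> j = Suc i"
  obtains k where "layer_cut p k" "k < n" "p ! k = n"
proof -
  let ?S = "{k. layer_cut p k \<and> k < n}"
  have fin: "finite ?S" by simp
  have "0 \<in> ?S" using n by (simp add: layer_cut_def)
  then have max: "Max ?S \<in> ?S" using fin Max_in by blast
  define k where "k = Max ?S"
  have k: "layer_cut p k" "k < n" using max by (auto simp: k_def)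
  note nx = layer_cut_next[OF p adj k]
  have "p ! k \<notin> ?S"
  proof
    assume "p ! k \<in> ?S"
    with fin have "p ! k \<le> k" unfolding k_def by (rule Max_ge)
    then show False using nx(1) by simp
  qed
  then have "\<not> p ! k < n" using nx(3) by blast
  moreover have "p ! k \<le> n" using nx(3) p unfolding layer_cut_def is_perm_def by metis
  ultimately have "p ! k = n" by linarith
  then show ?thesis using that k by blast
qed

lemma contains_pattern_layered:
  assumes p: "is_perm n p" and n: "n \<ge> 1"
    and adj: "\<forall>i j. i < j \<and> j < n \<and> p ! i = Suc (p ! j) \<longrightarrow> j = Suc i"
  shows "contains_pattern (zigzag_word n) p"
proof -
  have len: "length p = n" and set: "set p = {1..n}"
    using p by (auto simp: is_perm_def)
  have range: "p ! i \<in> {1..n}" if "i < n" for i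
    using that set len nth_mem by blast
  obtain k where k: "layer_cut p k" "k < n" "p ! k = n" using last_layer[OF p n adj] .
  note nx = layer_cut_next[OF p adj k(1,2), unfolded k(3)]
  have last: "p ! (n - 1) = Suc k" using nx(2)[of "n - 1 - k"] k(2) by auto
  have run_n: "greedy_run ((!) p) (n - 1) = layer_end n (Suc k)"
    using nx(3) n last by (auto simp: layer_cut_def)
  have img: "(!) p ` {..<k} = {1..k}" using k by (simp add: layer_cut_def)
  show ?thesis
  \<comment> \<open>\<open>layer_end n (Suc k)\<close> exceeds \<open>n\<close>, being
    \<open>n + 1\<close>, only if \<open>n\<close> and \<open>k\<close> are both even.\<close>
  proof (cases "even n \<and> even k")
    case False
    then have "greedy_run ((!) p) (n - 1) \<le> n" using run_n by (auto simp: layer_end_def)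
    then show ?thesis using range by (intro contains_pattern_greedy[OF p]) auto
  next
    case True
    then have "even (n - k)" by simp
    then obtain m where "n - k = 2 * m" by blast
    then have m: "n = k + 2 * m" "m \<ge> 1" using k(2) by auto
    \<comment> \<open>\<open>m\<close> copies of \<open>n - 1\<close> in the odd runs \<open>k + 1, k + 3, ..., n - 1\<close>, the rest in run \<open>n\<close>;
      the value \<open>n - 1\<close> in the even run \<open>n\<close> is the extra cell.\<close>
    define top where "top = (\<lambda>t. if t < m then (k + 1 + 2 * t, n - 1)
      else (n, if t = m then n - 1 else n - 2 * (t - m)))"
    define h where "h = (\<lambda>i. if i < k then (greedy_run ((!) p) i, p ! i) else top (i - k))"
    have low: "p ! i \<in> {1..k}" if "i < k" for i using img that by blast
    have high: "p ! i = n - (i - k)" "k < p ! i" if "k \<le> i" "i < n" for i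
      using nx(2)[of "i - k"] that by auto
    \<comment> \<open>Sharing run \<open>k + 1\<close> with the last layer is harmless: it is odd,
      hence increasing, and the lower letters are at most \<open>k\<close>, before
      \<open>n - 1\<close>.\<close>
    have run_k: "greedy_run ((!) p) i \<le> k + 1" if "i < k" for i
    proof -
      have "greedy_run ((!) p) i \<le> greedy_run ((!) p) (k - 1)"
        using that by (intro greedy_run_mono) auto
      also have "\<dots> \<le> k + 1" using k(1) that by (auto simp: layer_cut_def layer_end_def)
      finally show ?thesis .
    qed
    have top_snd: "k < snd (top t)" "snd (top t) \<le> n - 1" if "t < 2 * m" for t
      using that m by (auto simp: top_def)
    \<comment> \<open>Weak descent suffices on the last layer, as ties count as descents.\<close>
    have top_antimono: "snd (top t) \<le> snd (top s)" if "s \<le> t" for s t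
      unfolding top_def using that by auto
    show ?thesis
    proof (rule contains_pattern_zigzag_wordI[OF p, where h = h])
      fix i assume i: "i < n"
      show "h i \<in> cells n"
      proof (cases "i < k")
        case True
        then show ?thesis
          using low[OF True] run_k[OF True] k(2) even_greedy_run[of "(!) p" i]
            greedy_run_ge_1[of "(!) p" i] by (auto simp: h_def cells_def)
      next
        case False
        then show ?thesis using i m True top_snd[of "i - k"]
          by (auto simp: h_def top_def cells_def)
      qed
    next
      fix i assume i: "Suc i < n"
      consider "Suc i < k" | "Suc i = k" | "k \<le> i" by linarith
      then show "cell_less (h i) (h (Suc i))"
      proof cases
        case 1
        then show ?thesis using cell_less_greedy_run[of "(!) p" i] by (simp add: h_def)
      next
        case 2
        then show ?thesis using run_k[of i] low[of i] m True
          by (auto simp: h_def top_def cell_less_def run_less_def)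
      next
        case 3
        then obtain t where t: "i = k + t" using le_iff_add by blast
        then have "Suc t < 2 * m" using i m by simp
        then have "cell_less (top t) (top (Suc t))"
          using m True by (auto simp: top_def cell_less_def run_less_def)
        then show ?thesis using t by (simp add: h_def)
      qed
    next
      fix i j assume ij: "i < j" "j < n"
      consider "j < k" | "i < k" "k \<le> j" | "k \<le> i" by linarith
      then show "p ! i < p ! j \<longleftrightarrow> snd (h i) < snd (h j)"
      proof cases
        case 1
        then show ?thesis using ij by (simp add: h_def)
      next
        case 2
        then have "p ! i \<le> k" "k < p ! j" "snd (h i) = p ! i" "h j = top (j - k)" "j - k < 2 * m"
          using low[of i] high[of j] ij m by (auto simp: h_def)
        moreover from this(5) have "k < snd (top (j - k))" by (rule top_snd(1))
        ultimately show ?thesis by simp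
      next
        case 3
        have "p ! i = n - (i - k)" "p ! j = n - (j - k)" using high(1) 3 ij by simp_all
        then have "p ! j < p ! i" using 3 ij by linarith
        moreover have "snd (top (j - k)) \<le> snd (top (i - k))"
          using 3 ij by (intro top_antimono) linarith
        moreover have "h i = top (i - k)" "h j = top (j - k)" using 3 ij by (auto simp: h_def)
        ultimately show ?thesis by simp
      qed
    qed
  qed
qed

section \<open>Combining the two cases\<close>

theorem theorem6p4:
  fixes n :: nat
  assumes "n \<ge> 1"
  shows "\<exists>w :: nat list. (\<forall>x\<in>set w. x \<ge> 1) \<and>
           length w = nat \<lceil>(real n ^ 2 + 1) / 2\<rceil> \<and>
           (\<forall>p. is_perm n p \<longrightarrow> contains_pattern w p)"
proof (intro exI[of _ "zigzag_word n"] conjI ballI allI impI)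
  show "length (zigzag_word n) = nat \<lceil>(real n ^ 2 + 1) / 2\<rceil>"
    using card_cells[OF assms] length_zigzag_word by simp
next
  fix p assume p: "is_perm n p"
  show "contains_pattern (zigzag_word n) p"
  proof (cases "\<exists>i j. Suc i < j \<and> j < n \<and> p ! i = Suc (p ! j)")
    case True
    then show ?thesis using contains_pattern_distant[OF p] by blast
  next
    case False
    then have "\<forall>i j. i < j \<and> j < n \<and> p ! i = Suc (p ! j) \<longrightarrow> j = Suc i"
      by (metis Suc_lessI)
    then show ?thesis using contains_pattern_layered[OF p assms] by blast
  qed
qed (rule zigzag_word_pos)

end
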